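(* Let $\beta\ge 2$ be a (real) algebraic number. Then for any sequence $\{\varepsilon_n\}_{n\in\mathbb{N}}$ of positive real numbers there exist $s,t\in\mathbb{R}$ such that the iterated function system $\Phi_{\beta,s,t}$ has no exact overlaps and $$\Delta_n(\beta,s,t)\le \varepsilon_n \quad \text{for all } n\in\mathbb{N}.$$
   Context: $\mathbb{N}=\{1,2,3,\ldots\}$. For real $\beta\ge 2$ and $s,t\in\mathbb{R}$, $\Phi_{\beta,s,t}=\{\varphi_i\}_{i\in\Lambda}$ with $\Lambda=\{1,2,3,4\}$ is the iterated function system on $\mathbb{R}$ given by $$\varphi_1(x)=\frac{x}{\beta},\quad \varphi_2(x)=\frac{x+1}{\beta},\quad \varphi_3(x)=\frac{x+s}{\beta},\quad \varphi_4(x)=\frac{x+t}{\beta}.$$ For a word $\mathbf{i}=i_1\ldots i_n\in\Lambda^n$ put $\varphi_{\mathbf{i}}=\varphi_{i_1}\circ\cdots\circ\varphi_{i_n}$. The system has exact overlaps if there exist $n\in\mathbb{N}$ and $\mathbf{i},\mathbf{j}\in\Lambda^n$ with $\mathbf{i}\ne\mathbf{j}$ such that $\varphi_{\mathbf{i}}=\varphi_{\mathbf{j}}$. For $n\in\mathbb{N}$, $$\Delta_n(\beta,s,t)=\min\{|\varphi_{\mathbf{i}}(0)-\varphi_{\mathbf{j}}(0)| : \mathbf{i},\mathbf{j}\in\Lambda^n,\ \mathbf{i}\ne\mathbf{j}\}.$$ *)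

theory Defs
  imports Complex_Main "HOL-Computational_Algebra.Polynomial"
begin

definition Lambda :: "nat set" where
  "Lambda = {1, 2, 3, 4}"

text \<open>The map for an index outside \<^const>\<open>Lambda\<close> is irrelevant; it is the fourth map.\<close>

definition ifs_map :: "real \<Rightarrow> real \<Rightarrow> real \<Rightarrow> nat \<Rightarrow> real \<Rightarrow> real" where
  "ifs_map \<beta> s t i x =
     (if i = 1 then x / \<beta>
      else if i = 2 then (x + 1) / \<beta>
      else if i = 3 then (x + s) / \<beta>
      else (x + t) / \<beta>)"

definition words :: "nat \<Rightarrow> nat list set" where
  "words n = {w. set w \<subseteq> Lambda \<and> length w = n}"

fun word_map :: "real \<Rightarrow> real \<Rightarrow> real \<Rightarrow> nat list \<Rightarrow> real \<Rightarrow> real" where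
  "word_map \<beta> s t [] = id"
| "word_map \<beta> s t (i # w) = ifs_map \<beta> s t i \<circ> word_map \<beta> s t w"

definition has_exact_overlaps :: "real \<Rightarrow> real \<Rightarrow> real \<Rightarrow> bool" where
  "has_exact_overlaps \<beta> s t \<longleftrightarrow>
     (\<exists>n\<ge>1. \<exists>u\<in>words n. \<exists>v\<in>words n. u \<noteq> v \<and> word_map \<beta> s t u = word_map \<beta> s t v)"

definition separations :: "real \<Rightarrow> real \<Rightarrow> real \<Rightarrow> nat \<Rightarrow> real set" where
  "separations \<beta> s t n =
     {\<bar>word_map \<beta> s t u 0 - word_map \<beta> s t v 0\<bar> | u v. u \<in> words n \<and> v \<in> words n \<and> u \<noteq> v}"

text \<open>Only meaningful for \<open>n \<ge> 1\<close>, where the minimum is over a finite nonempty set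
  (see the two lemmas below); there is only one word of length \<open>0\<close>.\<close>

definition Delta :: "nat \<Rightarrow> real \<Rightarrow> real \<Rightarrow> real \<Rightarrow> real" where
  "Delta n \<beta> s t = Min (separations \<beta> s t n)"

lemma finite_separations: "finite (separations \<beta> s t n)"
proof -
  have "finite (words n)"
    unfolding words_def by (rule finite_lists_length_eq) (simp add: Lambda_def)
  moreover have "separations \<beta> s t n \<subseteq>
      (\<lambda>(u, v). \<bar>word_map \<beta> s t u 0 - word_map \<beta> s t v 0\<bar>) ` (words n \<times> words n)"
    unfolding separations_def by auto
  ultimately show ?thesis
    by (meson finite_SigmaI finite_imageI finite_subset)
qed

lemma separations_nonempty:
  assumes "n \<ge> 1"
  shows "separations \<beta> s t n \<noteq> {}"
proof -
  have "replicate n 1 \<in> words n" "replicate n 2 \<in> words n"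
    by (auto simp: words_def Lambda_def)
  moreover have "replicate n (1::nat) \<noteq> replicate n 2"
    using assms by (cases n) auto
  ultimately show ?thesis
    unfolding separations_def by blast
qed

end

theory Submission
  imports Defs
begin

text \<open>
  Put \<open>x = 1/\<beta> \<le> 1/2\<close>. The parameters are two interleaved lacunary series
  \<open>s = (\<Sum>k even. x ^ N k)\<close> and \<open>t = (\<Sum>k odd. x ^ N k)\<close> with \<open>N 0 = 0\<close> and \<open>N\<close> increasing
  extremely fast; \<open>N (k + 1)\<close> is chosen after \<open>N k\<close>.

  \<^emph>\<open>Closeness.\<close> A truncation of \<open>s\<close> or \<open>t\<close> is a sum of distinct powers of \<open>x\<close>, so up to
  the factor \<open>x\<close> it is the value of a word in the letters 1 and 2, whereas \<open>s\<close> and \<open>t\<close> themselves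
  are, up to the same factor, values of words that start with 3 or 4
  (\<open>Delta_le_truncation_error\<close>). If \<open>N k < n \<le> N (k + 1)\<close>, words of length \<open>n\<close> are long enough
  for truncation at \<open>N k\<close>, and for the series that contains the exponent \<open>N k\<close> the next exponent is
  \<open>N (k + 2)\<close>; since \<open>N 0 = 0\<close>, every \<open>n \<ge> 1\<close> is in one of these ranges. Hence \<open>Delta n\<close> is at
  most about \<open>x ^ N (k + 2)\<close>, and \<open>N (k + 2)\<close> is chosen after \<open>N (k + 1)\<close>, hence in view of all the
  bounds \<open>\<epsilon> n\<close> with \<open>n \<le> N (k + 1)\<close> (\<open>next_exponent\<close>). With a single series the error would be
  about \<open>x ^ N (k + 1)\<close>, to be compared with \<open>\<epsilon> n\<close> up to the same \<open>n = N (k + 1)\<close>.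

  \<^emph>\<open>No exact overlaps.\<close> An overlap of two words is a relation \<open>a + s * b + t * c = 0\<close> whose
  coefficients are differences of sums of distinct powers of \<open>x\<close>. Replacing \<open>s\<close> and \<open>t\<close> by
  their truncations at \<open>N k\<close> changes the left-hand side by \<open>O(x ^ N (k + 1))\<close>. The resulting number
  lies, once \<open>N k\<close> is at least the word length, in a finite set determined by \<open>N k\<close>, so if
  \<open>N (k + 1)\<close> was chosen large enough it must vanish. The relation thus holds for all late
  truncations, and subtracting consecutive ones gives \<open>b = 0\<close> and \<open>c = 0\<close>, hence \<open>a = 0\<close>. Since \<open>x \<le> 1/2\<close>, a finite
  sum of distinct powers of \<open>x\<close> determines its exponents (\<open>digit_sum_inj\<close>), so the two
  words agree.
\<close>

section \<open>Sums of distinct powers\<close>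

definition digit_sum :: "real \<Rightarrow> nat set \<Rightarrow> real" where
  "digit_sum x E = (\<Sum>i. of_bool (i \<in> E) * x ^ i)"

lemma summable_digits:
  fixes x :: real
  assumes "0 < x" "x \<le> 1/2"
  shows "summable (\<lambda>i. of_bool (i \<in> E) * x ^ i)"
  by (rule summable_comparison_test'[where g = "\<lambda>i. x ^ i" and N = 0])
     (use assms in \<open>auto intro: summable_geometric\<close>)

lemma digit_sum_finite: "finite E \<Longrightarrow> digit_sum x E = (\<Sum>i\<in>E. x ^ i)"
  unfolding digit_sum_def by (subst suminf_finite[of E]) auto

lemma digit_sum_Un_disjoint:
  assumes "0 < x" "x \<le> 1/2" "A \<inter> B = {}"
  shows "digit_sum x (A \<union> B) = digit_sum x A + digit_sum x B"
proof -
  have "of_bool (i \<in> A \<union> B) * x ^ i = of_bool (i \<in> A) * x ^ i + of_bool (i \<in> B) * x ^ i" for i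
    using assms(3) by auto
  then show ?thesis
    unfolding digit_sum_def
    by (simp only: suminf_add[OF summable_digits summable_digits] assms)
qed

lemma digit_sum_nonneg:
  assumes "0 < x" "x \<le> 1/2"
  shows "0 \<le> digit_sum x E"
  unfolding digit_sum_def using assms by (intro suminf_nonneg summable_digits) auto

lemma digit_sum_le:
  assumes x: "0 < x" "x \<le> 1/2" and E: "\<And>i. i \<in> E \<Longrightarrow> L \<le> i"
  shows "digit_sum x E \<le> 2 * x ^ L"
proof -
  let ?f = "\<lambda>i. of_bool (i \<in> E) * x ^ i"
  have "(\<Sum>i<L. ?f i) = 0"
    using E by (intro sum.neutral) fastforce
  then have "digit_sum x E = (\<Sum>i. ?f (i + L))"
    unfolding digit_sum_def
    using suminf_split_initial_segment[OF summable_digits[OF x, of E], of L] by simp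
  also have "\<dots> \<le> (\<Sum>i. x ^ L * x ^ i)"
    using x summable_ignore_initial_segment[OF summable_digits[OF x, of E], of L]
    by (intro suminf_le summable_mult summable_geometric) (auto simp: power_add)
  also have "\<dots> = x ^ L * (1 / (1 - x))"
    using x by (simp add: suminf_mult suminf_geometric summable_geometric)
  also have "\<dots> \<le> x ^ L * 2"
    using x by (intro mult_left_mono) (auto simp: field_simps)
  finally show ?thesis by simp
qed

lemma digit_sum_tail:
  assumes x: "0 < x" "x \<le> 1/2" and E: "\<And>i. i \<in> E \<Longrightarrow> i \<notin> A \<Longrightarrow> L \<le> i"
  shows "\<bar>digit_sum x E - digit_sum x (E \<inter> A)\<bar> \<le> 2 * x ^ L"
proof -
  have "digit_sum x ((E \<inter> A) \<union> (E - A)) = digit_sum x (E \<inter> A) + digit_sum x (E - A)"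
    by (rule digit_sum_Un_disjoint[OF x]) auto
  moreover have "(E \<inter> A) \<union> (E - A) = E" by blast
  moreover have "digit_sum x (E - A) \<le> 2 * x ^ L" "0 \<le> digit_sum x (E - A)"
    using E by (auto intro!: digit_sum_le digit_sum_nonneg x)
  ultimately show ?thesis by simp
qed

text \<open>The smallest exponent in which two sums differ outweighs all later ones together. For \<open>x = 1/2\<close>
  this needs finiteness: infinite binary expansions are not unique.\<close>

lemma digit_sum_less:
  assumes x: "0 < x" "x \<le> 1/2" and F: "finite F" "\<And>i. i \<in> F \<Longrightarrow> m < i"
  shows "digit_sum x F < x ^ m"
proof -
  \<comment> \<open>Strictness: a further exponent \<open>d\<close> still leaves the sum below \<open>2 * x ^ (m + 1) \<le> x ^ m\<close>.\<close>
  obtain d where d: "m < d" "d \<notin> F"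
    using F(1) infinite_Ioi[of m] by (meson finite_subset greaterThan_iff subsetI)
  have "digit_sum x F < digit_sum x (insert d F)"
    using F(1) d(2) x by (simp add: digit_sum_finite)
  also have "\<dots> \<le> 2 * x ^ Suc m"
    using F(2) d(1) by (intro digit_sum_le[OF x]) (auto simp: Suc_le_eq)
  also have "\<dots> \<le> x ^ m"
    using x mult_right_mono[of "2 * x" 1 "x ^ m"] by simp
  finally show ?thesis .
qed

lemma digit_sum_inj:
  assumes x: "0 < x" "x \<le> 1/2" and fin: "finite E" "finite F"
    and eq: "digit_sum x E = digit_sum x F"
  shows "E = F"
proof (rule ccontr)
  assume "E \<noteq> F"
  define m where "m = (LEAST i. (i \<in> E) \<noteq> (i \<in> F))"
  have m: "(m \<in> E) \<noteq> (m \<in> F)"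
    unfolding m_def
  proof (rule LeastI_ex)
    show "\<exists>i. (i \<in> E) \<noteq> (i \<in> F)" using \<open>E \<noteq> F\<close> by blast
  qed
  have least: "m \<le> i" if "(i \<in> E) \<noteq> (i \<in> F)" for i
    unfolding m_def using that by (rule Least_le)
  have less: "digit_sum x (B - A) < digit_sum x (A - B)"
    if "m \<in> A - B" "finite A" "finite B" and AB: "\<And>i. i \<in> B - A \<Longrightarrow> m \<le> i" for A B
  proof -
    have "digit_sum x (B - A) < x ^ m"
    proof (rule digit_sum_less[OF x])
      show "finite (B - A)" using \<open>finite B\<close> by simp
      show "m < i" if "i \<in> B - A" for i
        using AB[OF that] that \<open>m \<in> A - B\<close> by (cases "i = m") auto
    qed
    also have "\<dots> \<le> digit_sum x (A - B)"
      using that(1,2) x member_le_sum[of m "A - B" "\<lambda>i. x ^ i"] by (simp add: digit_sum_finite)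
    finally show ?thesis .
  qed
  have split: "digit_sum x A = digit_sum x (A \<inter> B) + digit_sum x (A - B)" for A B
    using digit_sum_Un_disjoint[OF x, of "A \<inter> B" "A - B"] by (simp only: Int_Diff_Un Int_Diff_disjoint)
  have eq': "digit_sum x (E - F) = digit_sum x (F - E)"
    using split[of E F] split[of F E] eq unfolding Int_commute[of F E] by linarith
  show False
  proof (cases "m \<in> E")
    case True
    then have "digit_sum x (F - E) < digit_sum x (E - F)"
      using m least fin by (intro less) auto
    with eq' show False by simp
  next
    case False
    then have "digit_sum x (E - F) < digit_sum x (F - E)"
      using m least fin by (intro less) auto
    with eq' show False by simp
  qed
qed

section \<open>Values of words\<close>

definition positions :: "nat \<Rightarrow> nat list \<Rightarrow> nat set" where
  "positions j w = {i. i < length w \<and> w ! i = j}"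

lemma finite_positions: "finite (positions j w)"
  by (simp add: positions_def)

lemma positions_Nil: "positions j [] = {}"
  by (simp add: positions_def)

lemma positions_Cons: "positions j (i # w) = (if i = j then {0} else {}) \<union> Suc ` positions j w"
proof (rule set_eqI)
  fix k
  show "k \<in> positions j (i # w) \<longleftrightarrow> k \<in> (if i = j then {0} else {}) \<union> Suc ` positions j w"
    by (cases k) (auto simp: positions_def)
qed

lemma digit_sum_positions_Cons:
  "digit_sum x (positions j (i # w)) = of_bool (i = j) + x * digit_sum x (positions j w)"
proof -
  have "(\<Sum>k\<in>Suc ` positions j w. x ^ k) = x * (\<Sum>k\<in>positions j w. x ^ k)"
    by (simp add: sum.reindex sum_distrib_left)
  then show ?thesis
    by (simp add: positions_Cons digit_sum_finite finite_positions)
qed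

lemma word_map_zero:
  assumes "set w \<subseteq> Lambda"
  shows "word_map \<beta> s t w 0 = 1/\<beta> * (digit_sum (1/\<beta>) (positions 2 w)
    + s * digit_sum (1/\<beta>) (positions 3 w) + t * digit_sum (1/\<beta>) (positions 4 w))"
  using assms
proof (induction w)
  case Nil
  then show ?case by (simp add: positions_Nil digit_sum_finite)
next
  case (Cons i w)
  then show ?case
    by (auto simp: ifs_map_def digit_sum_positions_Cons Lambda_def algebra_simps add_divide_distrib)
qed

lemma words_eqI:
  assumes "u \<in> words n" "v \<in> words n" and "\<And>j. j \<in> {2, 3, 4} \<Longrightarrow> positions j u = positions j v"
  shows "u = v"
proof (rule nth_equalityI)
  show len: "length u = length v" using assms(1,2) by (simp add: words_def)
  fix i assume i: "i < length u"
  then have "u ! i \<in> Lambda" "v ! i \<in> Lambda"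
    using assms(1,2) len by (auto simp: words_def subset_iff)
  then have "u ! i \<in> {1, 2, 3, 4}" "v ! i \<in> {1, 2, 3, 4}"
    by (simp_all add: Lambda_def)
  moreover have "u ! i = j \<longleftrightarrow> v ! i = j" if "j \<in> {2, 3, 4}" for j
    using assms(3)[OF that] i len by (auto simp: positions_def)
  ultimately show "u ! i = v ! i" by auto
qed

text \<open>The letter 3 or 4 followed by letters 1 is compared with the word in the letters 1 and 2 that
  spells the set \<open>E\<close>.\<close>

lemma Delta_le_truncation_error:
  assumes \<beta>: "\<beta> > 0" and n: "n \<ge> 1" and r: "(j :: nat, r) \<in> {(3, s), (4, t)}"
  shows "Delta n \<beta> s t \<le> 1/\<beta> * \<bar>r - digit_sum (1/\<beta>) (E \<inter> {..<n})\<bar>"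
proof -
  define u where "u = j # replicate (n - 1) 1"
  define v where "v = map (\<lambda>i. if i \<in> E then 2 else 1 :: nat) [0..<n]"
  have u: "u \<in> words n" and v: "v \<in> words n"
    using n r by (auto simp: u_def v_def words_def Lambda_def)
  have "hd u \<noteq> hd v"
    using n r by (auto simp: u_def v_def hd_map)
  then have uv: "u \<noteq> v" by auto
  have ones: "positions i (replicate k (Suc 0)) = {}" if "i \<noteq> 1" for i k
    using that by (auto simp: positions_def)
  have pos_v: "positions 2 v = E \<inter> {..<n}" "positions 3 v = {}" "positions 4 v = {}"
    by (auto simp: positions_def v_def split: if_splits)
  have "word_map \<beta> s t u 0 = 1/\<beta> * r"
    using r u by (subst word_map_zero) (auto simp: words_def u_def digit_sum_positions_Cons ones digit_sum_finite)
  moreover have "word_map \<beta> s t v 0 = 1/\<beta> * digit_sum (1/\<beta>) (E \<inter> {..<n})"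
    using v by (subst word_map_zero) (auto simp: words_def pos_v digit_sum_finite)
  ultimately have "word_map \<beta> s t u 0 - word_map \<beta> s t v 0 = 1/\<beta> * (r - digit_sum (1/\<beta>) (E \<inter> {..<n}))"
    by (simp add: algebra_simps)
  then have "1/\<beta> * \<bar>r - digit_sum (1/\<beta>) (E \<inter> {..<n})\<bar> = \<bar>word_map \<beta> s t u 0 - word_map \<beta> s t v 0\<bar>"
    using \<beta> by (simp add: abs_mult)
  then show ?thesis
    unfolding Delta_def using u v uv
    by (intro Min_le finite_separations) (auto simp: separations_def)
qed

text \<open>The coefficients \<open>a\<close>, \<open>b\<close>, \<open>c\<close> compare the positions of the letters 2, 3, 4 in the two words, each
  being a difference of two digit sums between 0 and 2. They do not depend on \<open>(s, t)\<close>, so the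
  same relation can be evaluated at different parameters.\<close>

lemma word_difference:
  assumes \<beta>: "\<beta> \<ge> 2" and "u \<in> words n" "v \<in> words n"
  obtains a b c where
    "\<And>s t. word_map \<beta> s t u 0 - word_map \<beta> s t v 0 = 1/\<beta> * (a + s * b + t * c)"
    "\<bar>b\<bar> \<le> 2" "\<bar>c\<bar> \<le> 2"
    "a = 0 \<Longrightarrow> b = 0 \<Longrightarrow> c = 0 \<Longrightarrow> u = v"
proof
  let ?x = "1/\<beta>"
  let ?d = "\<lambda>j. digit_sum ?x (positions j u) - digit_sum ?x (positions j v)"
  have x: "0 < ?x" "?x \<le> 1/2" using \<beta> by (auto simp: field_simps)
  show "word_map \<beta> s t u 0 - word_map \<beta> s t v 0 = ?x * (?d 2 + s * ?d 3 + t * ?d 4)" for s t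
    using assms(2,3) by (simp add: words_def word_map_zero algebra_simps)
  have "\<bar>?d j\<bar> \<le> 2" for j
    using digit_sum_nonneg[OF x, of "positions j u"] digit_sum_le[OF x, of "positions j u" 0]
      digit_sum_nonneg[OF x, of "positions j v"] digit_sum_le[OF x, of "positions j v" 0] by simp
  then show "\<bar>?d 3\<bar> \<le> 2" "\<bar>?d 4\<bar> \<le> 2" by blast+
  have pos: "positions j u = positions j v" if "?d j = 0" for j
    using that by (intro digit_sum_inj[OF x]) (auto simp: finite_positions)
  show "u = v" if "?d 2 = 0" "?d 3 = 0" "?d 4 = 0"
    using that by (intro words_eqI[OF assms(2,3)]) (auto intro!: pos)
qed

section \<open>Choice of the exponents\<close>

text \<open>This is the growth condition on \<open>N (k + 1)\<close> given \<open>M = N k\<close>. The last clause quantifies over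
  all parameters that are sums of powers up to \<open>M\<close>, not over the truncations actually used: these are
  still finitely many, and so the next exponent depends on the previous one only.\<close>

lemma next_exponent:
  fixes \<epsilon> :: "nat \<Rightarrow> real"
  assumes \<beta>: "\<beta> \<ge> 2" and \<epsilon>: "\<And>n. n \<ge> 1 \<Longrightarrow> \<epsilon> n > 0"
  obtains L where "L > M"
    "\<And>n. 1 \<le> n \<Longrightarrow> n \<le> M \<Longrightarrow> 8 * (1/\<beta>) ^ L < \<epsilon> n"
    "\<And>I J n z. I \<subseteq> {..M} \<Longrightarrow> J \<subseteq> {..M} \<Longrightarrow> n \<le> M \<Longrightarrow>
       z \<in> separations \<beta> (digit_sum (1/\<beta>) I) (digit_sum (1/\<beta>) J) n \<Longrightarrow> z \<noteq> 0 \<Longrightarrow>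
       8 * (1/\<beta>) ^ L < z"
proof -
  define Z where "Z = (\<Union>I\<in>Pow {..M}. \<Union>J\<in>Pow {..M}. \<Union>n\<in>{..M}.
    separations \<beta> (digit_sum (1/\<beta>) I) (digit_sum (1/\<beta>) J) n)"
  define Q where "Q = insert 1 (\<epsilon> ` {1..M} \<union> (Z - {0}))"
  have fin: "finite Q"
    unfolding Q_def Z_def by (intro finite.insertI finite_UnI finite_imageI finite_Diff
        finite_UN_I finite_separations) auto
  have "\<forall>q\<in>Q. q > 0"
    using \<epsilon> by (auto simp: Q_def Z_def separations_def)
  then have pos: "Min Q > 0"
    using fin by (subst Min_gr_iff) (auto simp: Q_def)
  have "(\<lambda>L. (1/\<beta>) ^ L) \<longlonglongrightarrow> 0"
    using \<beta> by (intro LIMSEQ_power_zero) auto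
  then have "eventually (\<lambda>L. (1/\<beta>) ^ L < Min Q / 8) sequentially"
    by (rule order_tendstoD(2)) (simp add: pos)
  then have "eventually (\<lambda>L. (1/\<beta>) ^ L < Min Q / 8 \<and> L > M) sequentially"
    by (intro eventually_conj eventually_gt_at_top)
  then obtain L where "(1/\<beta>) ^ L < Min Q / 8" "L > M"
    using eventually_happens'[OF sequentially_bot] by blast
  then have L: "L > M" "8 * (1/\<beta>) ^ L < Min Q" by auto
  then have *: "8 * (1/\<beta>) ^ L < q" if "q \<in> Q" for q
    using Min_le[OF fin that] by linarith
  show ?thesis
  proof (rule that[OF L(1)])
    show "8 * (1/\<beta>) ^ L < \<epsilon> n" if "1 \<le> n" "n \<le> M" for n
      using that by (intro *) (auto simp: Q_def)
    show "8 * (1/\<beta>) ^ L < z" if "I \<subseteq> {..M}" "J \<subseteq> {..M}" "n \<le> M"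
       "z \<in> separations \<beta> (digit_sum (1/\<beta>) I) (digit_sum (1/\<beta>) J) n" "z \<noteq> 0" for I J n z
      using that by (intro *) (auto simp: Q_def Z_def)
  qed
qed

lemma exponent_sequence:
  fixes \<epsilon> :: "nat \<Rightarrow> real"
  assumes \<beta>: "\<beta> \<ge> 2" and \<epsilon>: "\<And>n. n \<ge> 1 \<Longrightarrow> \<epsilon> n > 0"
  obtains N where "N 0 = 0" "strict_mono N"
    "\<And>k n. 1 \<le> n \<Longrightarrow> n \<le> N k \<Longrightarrow> 8 * (1/\<beta>) ^ N (Suc k) < \<epsilon> n"
    "\<And>I J n k z. I \<subseteq> {..N k} \<Longrightarrow> J \<subseteq> {..N k} \<Longrightarrow> n \<le> N k \<Longrightarrow>
       z \<in> separations \<beta> (digit_sum (1/\<beta>) I) (digit_sum (1/\<beta>) J) n \<Longrightarrow> z \<noteq> 0 \<Longrightarrow>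
       8 * (1/\<beta>) ^ N (Suc k) < z"
proof -
  define good where "good M L \<longleftrightarrow> L > M \<and> (\<forall>n. 1 \<le> n \<longrightarrow> n \<le> M \<longrightarrow> 8 * (1/\<beta>) ^ L < \<epsilon> n) \<and>
    (\<forall>I J n z. I \<subseteq> {..M} \<longrightarrow> J \<subseteq> {..M} \<longrightarrow> n \<le> M \<longrightarrow>
       z \<in> separations \<beta> (digit_sum (1/\<beta>) I) (digit_sum (1/\<beta>) J) n \<longrightarrow> z \<noteq> 0 \<longrightarrow>
       8 * (1/\<beta>) ^ L < z)" for M L
  have "\<exists>L. good M L" for M
    by (rule next_exponent[where \<epsilon> = \<epsilon> and M = M, OF \<beta> \<epsilon>], simp, rule exI, unfold good_def) blast
  then obtain nxt where nxt: "\<And>M. good M (nxt M)" by metis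
  define N :: "nat \<Rightarrow> nat" where "N k = (nxt ^^ k) 0" for k
  have N0: "N 0 = 0" and good: "good (N k) (N (Suc k))" for k
    using nxt by (simp_all add: N_def)
  have "strict_mono N"
    using good by (simp add: strict_mono_Suc_iff good_def)
  with N0 show ?thesis
    using good by (intro that[of N]) (unfold good_def, blast+)
qed

section \<open>Two interleaved lacunary series\<close>

theorem theorem1p2:
  fixes \<beta> :: real and \<epsilon> :: "nat \<Rightarrow> real"
  assumes "\<beta> \<ge> 2" and "algebraic \<beta>"
    and "\<And>n. n \<ge> 1 \<Longrightarrow> \<epsilon> n > 0"
  shows "\<exists>s t :: real. \<not> has_exact_overlaps \<beta> s t \<and> (\<forall>n\<ge>1. Delta n \<beta> s t \<le> \<epsilon> n)"
proof -
  define x where "x = 1/\<beta>"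
  have x: "0 < x" "x \<le> 1/2" using assms(1) by (auto simp: x_def field_simps)
  obtain N where N0: "N 0 = 0" and mono: "strict_mono N"
    and N_close: "\<And>k n. 1 \<le> n \<Longrightarrow> n \<le> N k \<Longrightarrow> 8 * x ^ N (Suc k) < \<epsilon> n"
    and N_sep: "\<And>I J n k z. I \<subseteq> {..N k} \<Longrightarrow> J \<subseteq> {..N k} \<Longrightarrow> n \<le> N k \<Longrightarrow>
      z \<in> separations \<beta> (digit_sum x I) (digit_sum x J) n \<Longrightarrow> z \<noteq> 0 \<Longrightarrow> 8 * x ^ N (Suc k) < z"
    using exponent_sequence[where \<epsilon> = \<epsilon>, OF assms(1,3)] unfolding x_def[symmetric] by blast
  define P where "P e = N ` {k. even k = e}" for e
  define s where "s = digit_sum x (P True)"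
  define t where "t = digit_sum x (P False)"
  define tr where "tr e k = digit_sum x (P e \<inter> {..N k})" for e k

  have gap: "N (Suc k) \<le> i" if "i \<in> P e" "\<not> i \<le> N k" for i e k
    using that strict_mono_less_eq[OF mono] by (auto simp: P_def Suc_le_eq)
  have gap2: "N (Suc (Suc k)) \<le> i" if "i \<in> P (even k)" "\<not> i \<le> N k" for i k
  proof -
    from that(1) obtain l where l: "i = N l" "even l = even k" by (auto simp: P_def)
    with that(2) have "k < l" using strict_mono_less_eq[OF mono, of l k] by simp
    moreover from l have "l \<noteq> Suc k" by auto
    ultimately show ?thesis using l strict_mono_less_eq[OF mono] by simp
  qed
  have small: "Delta n \<beta> s t \<le> \<epsilon> n" if n: "n \<ge> 1" for n
  proof -
    obtain k where k: "N k < n" "n \<le> N (Suc k)"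
    proof -
      define K where "K = (LEAST k. n \<le> N k)"
      have ex: "n \<le> N n" using strict_mono_imp_increasing[OF mono] .
      have "n \<le> N K" unfolding K_def using ex by (rule LeastI)
      moreover from this obtain k where "K = Suc k" using N0 n by (cases K) auto
      moreover from this have "\<not> n \<le> N k" using not_less_Least[of k "\<lambda>k. n \<le> N k"] K_def by simp
      ultimately show ?thesis using that by force
    qed
    define r where "r = (if even k then s else t)"
    have r: "r = digit_sum x (P (even k))" by (simp add: r_def s_def t_def)
    have "Delta n \<beta> s t \<le> 1/\<beta> * \<bar>r - digit_sum (1/\<beta>) (P (even k) \<inter> {..<n})\<bar>"
      using assms(1) n
      by (intro Delta_le_truncation_error[where j = "if even k then 3 else 4"]) (auto simp: r_def)
    also have "\<dots> = x * \<bar>digit_sum x (P (even k)) - digit_sum x (P (even k) \<inter> {..<n})\<bar>"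
      by (simp add: r x_def)
    also have "\<dots> \<le> 1 * (2 * x ^ N (Suc (Suc k)))"
      using x k by (intro mult_mono digit_sum_tail gap2) auto
    also have "\<dots> \<le> 8 * x ^ N (Suc (Suc k))" using x by simp
    also have "\<dots> < \<epsilon> n" using n k by (intro N_close)
    finally show ?thesis by simp
  qed

  have tr_Suc: "tr e (Suc k) = tr e k + of_bool (even (Suc k) = e) * x ^ N (Suc k)" for e k
  proof -
    define A where "A = (if even (Suc k) = e then {N (Suc k)} else {})"
    have "P e \<inter> {..N (Suc k)} = (P e \<inter> {..N k}) \<union> A"
      using strict_mono_less_eq[OF mono] by (auto simp: P_def A_def le_Suc_eq)
    moreover have "(P e \<inter> {..N k}) \<inter> A = {}"
      using strict_mono_less_eq[OF mono] by (auto simp: A_def)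
    ultimately show ?thesis
      unfolding tr_def by (simp only: digit_sum_Un_disjoint[OF x]) (simp add: A_def digit_sum_finite)
  qed
  have no: "\<not> has_exact_overlaps \<beta> s t"
  proof
    assume "has_exact_overlaps \<beta> s t"
    then obtain n u v where uv: "u \<in> words n" "v \<in> words n" "u \<noteq> v"
      and eq: "word_map \<beta> s t u = word_map \<beta> s t v"
      unfolding has_exact_overlaps_def by blast
    obtain a b c where abc: "\<And>s t. word_map \<beta> s t u 0 - word_map \<beta> s t v 0 = 1/\<beta> * (a + s * b + t * c)"
      and bc: "\<bar>b\<bar> \<le> 2" "\<bar>c\<bar> \<le> 2" and inj: "a = 0 \<Longrightarrow> b = 0 \<Longrightarrow> c = 0 \<Longrightarrow> u = v"
      using word_difference[OF assms(1) uv(1,2)] by metis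
    have rel: "a + s * b + t * c = 0"
      using abc[of s t] eq assms(1) by simp
    have vanish: "a + tr True k * b + tr False k * c = 0" if k: "n \<le> k" for k
    proof (rule ccontr)
      define y where "y = a + tr True k * b + tr False k * c"
      assume "a + tr True k * b + tr False k * c \<noteq> 0"
      then have y: "\<bar>1/\<beta> * y\<bar> \<noteq> 0" using assms(1) by (simp add: y_def)
      have "n \<le> N k" using strict_mono_imp_increasing[OF mono, of k] k by simp
      moreover have "\<bar>1/\<beta> * y\<bar> \<in> separations \<beta> (tr True k) (tr False k) n"
        unfolding separations_def y_def using uv abc[of "tr True k" "tr False k"] by force
      ultimately have "8 * x ^ N (Suc k) < \<bar>1/\<beta> * y\<bar>"
        using y unfolding tr_def by (intro N_sep[of _ k]) auto
      \<comment> \<open>The factor 8: two series, each with a tail of at most \<open>2 * x ^ N (Suc k)\<close> and a coefficient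
        of modulus at most 2.\<close>
      moreover have "\<bar>s - tr True k\<bar> \<le> 2 * x ^ N (Suc k)" "\<bar>t - tr False k\<bar> \<le> 2 * x ^ N (Suc k)"
        unfolding s_def t_def tr_def by (intro digit_sum_tail[OF x] gap; simp)+
      then have "\<bar>s - tr True k\<bar> * \<bar>b\<bar> \<le> (2 * x ^ N (Suc k)) * 2"
        "\<bar>t - tr False k\<bar> * \<bar>c\<bar> \<le> (2 * x ^ N (Suc k)) * 2"
        using bc x by (intro mult_mono; simp)+
      moreover have "y = - ((s - tr True k) * b + (t - tr False k) * c)"
        using rel by (simp add: y_def algebra_simps)
      then have "\<bar>y\<bar> \<le> \<bar>s - tr True k\<bar> * \<bar>b\<bar> + \<bar>t - tr False k\<bar> * \<bar>c\<bar>"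
        by (simp add: abs_mult[symmetric])
      moreover have "\<bar>1/\<beta> * y\<bar> \<le> \<bar>y\<bar>"
        using x by (simp only: x_def[symmetric] abs_mult) (auto intro: mult_left_le_one_le)
      ultimately show False by linarith
    qed
    \<comment> \<open>The step to an even index changes only the truncation of \<open>s\<close>, the step to an odd one only
      that of \<open>t\<close>.\<close>
    have "tr True (Suc (Suc (2 * n))) = tr True (Suc (2 * n)) + x ^ N (Suc (Suc (2 * n)))"
      "tr False (Suc (Suc (2 * n))) = tr False (Suc (2 * n))"
      by (subst tr_Suc; simp)+
    with vanish[of "Suc (2 * n)"] vanish[of "Suc (Suc (2 * n))"]
    have "x ^ N (Suc (Suc (2 * n))) * b = 0" by (simp add: distrib_right del: mult_eq_0_iff)
    then have "b = 0" using x by simp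
    moreover have "tr True (Suc (2 * n)) = tr True (2 * n)"
      "tr False (Suc (2 * n)) = tr False (2 * n) + x ^ N (Suc (2 * n))"
      by (subst tr_Suc; simp)+
    with vanish[of "2 * n"] vanish[of "Suc (2 * n)"]
    have "x ^ N (Suc (2 * n)) * c = 0" by (simp add: distrib_right del: mult_eq_0_iff)
    then have "c = 0" using x by simp
    ultimately show False using vanish[of n] inj uv(3) by simp
  qed
  show ?thesis using no small by blast
qed

end
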